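(* Let $G$ be a finite simple graph and $H$ a finite simple edge-transitive graph. If there exists a homomorphism from $G$ to $H$, then \[\frac{\lambda_{\max}(H)}{|\lambda_{\min}(H)|}\ge \max\left\{\frac{s^+(G)}{s^-(G)},\frac{s^-(G)}{s^+(G)}\right\},\] where $\lambda_{\max}(H),\lambda_{\min}(H)$ are the largest and smallest eigenvalues of the adjacency matrix of $H$.
   Context: A homomorphism $G\to H$ is a map $\phi:V(G)\to V(H)$ with $\phi(u)\phi(v)\in E(H)$ whenever $uv\in E(G)$. A graph is edge-transitive if its automorphism group acts transitively on its edge set. Writing $\lambda_1\ge\lambda_2\ge\cdots$ for the adjacency eigenvalues of $G$ (with multiplicity), $s^+(G)=\sum_{i:\lambda_i>0}\lambda_i^2$ and $s^-(G)=\sum_{j:\lambda_j<0}\lambda_j^2$. *)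

theory Defs
  imports
    "Graph_Theory.Pair_Digraph"
    "Jordan_Normal_Form.Spectral_Radius"
begin

text \<open>
  Finite simple graphs are the structures satisfying \<^const>\<open>pair_graph\<close>: finite vertex set,
  symmetric and irreflexive arc relation. An undirected edge \<open>uv\<close> is represented by the
  two arcs \<open>(u, v)\<close> and \<open>(v, u)\<close>.
\<close>

definition graph_hom :: "'a pair_pre_digraph \<Rightarrow> 'b pair_pre_digraph \<Rightarrow> ('a \<Rightarrow> 'b) \<Rightarrow> bool" where
  "graph_hom G H \<phi> \<longleftrightarrow>
     \<phi> \<in> pverts G \<rightarrow> pverts H \<and> (\<forall>u v. (u, v) \<in> parcs G \<longrightarrow> (\<phi> u, \<phi> v) \<in> parcs H)"

definition graph_aut :: "'a pair_pre_digraph \<Rightarrow> ('a \<Rightarrow> 'a) \<Rightarrow> bool" where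
  "graph_aut G \<phi> \<longleftrightarrow>
     bij_betw \<phi> (pverts G) (pverts G) \<and>
     (\<forall>u\<in>pverts G. \<forall>v\<in>pverts G. (u, v) \<in> parcs G \<longleftrightarrow> (\<phi> u, \<phi> v) \<in> parcs G)"

text \<open>
  Transitivity is required on undirected edges only, hence the comparison of unordered pairs:
  an automorphism may reverse the orientation.
\<close>

definition edge_transitive :: "'a pair_pre_digraph \<Rightarrow> bool" where
  "edge_transitive G \<longleftrightarrow>
     (\<forall>(u, v)\<in>parcs G. \<forall>(x, y)\<in>parcs G. \<exists>\<phi>. graph_aut G \<phi> \<and> {\<phi> u, \<phi> v} = {x, y})"

definition adj_mat_of :: "'a list \<Rightarrow> 'a pair_pre_digraph \<Rightarrow> real mat" where
  "adj_mat_of vs G =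
     mat (length vs) (length vs) (\<lambda>(i, j). if (vs ! i, vs ! j) \<in> parcs G then 1 else 0)"

text \<open>
  The rows and columns are indexed through an arbitrary enumeration of the vertices; by
  \<open>char_poly_adj_mat\<close> and \<open>spectrum_adj_mat\<close> below the choice is irrelevant.
\<close>

definition adj_mat :: "'a pair_pre_digraph \<Rightarrow> real mat" where
  "adj_mat G = adj_mat_of (SOME vs. distinct vs \<and> set vs = pverts G) G"

text \<open>
  The adjacency matrix is real symmetric, so all roots of its characteristic polynomial are real
  and the multiset of its real roots consists of all eigenvalues with multiplicity.
\<close>

definition adj_eigenvalues :: "'a pair_pre_digraph \<Rightarrow> real multiset" where
  "adj_eigenvalues G = proots (char_poly (adj_mat G))"

definition s_plus :: "'a pair_pre_digraph \<Rightarrow> real" where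
  "s_plus G = (\<Sum>x\<in>#filter_mset (\<lambda>x. x > 0) (adj_eigenvalues G). x\<^sup>2)"

definition s_minus :: "'a pair_pre_digraph \<Rightarrow> real" where
  "s_minus G = (\<Sum>x\<in>#filter_mset (\<lambda>x. x < 0) (adj_eigenvalues G). x\<^sup>2)"

definition lambda_max :: "'a pair_pre_digraph \<Rightarrow> real" where
  "lambda_max G = Max (spectrum (adj_mat G))"

definition lambda_min :: "'a pair_pre_digraph \<Rightarrow> real" where
  "lambda_min G = Min (spectrum (adj_mat G))"

lemma similar_adj_mat_of:
  assumes us: "distinct us" "set us = V" and vs: "distinct vs" "set vs = V"
  shows "similar_mat (adj_mat_of us G) (adj_mat_of vs G)"
proof -
  define n where "n = length us"
  have n: "length us = n" "length vs = n"
    using us vs by (metis n_def distinct_card)+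
  define p where "p i = (THE j. j < n \<and> vs ! j = us ! i)" for i
  have p: "p i < n \<and> vs ! p i = us ! i" if "i < n" for i
  proof -
    have "us ! i \<in> set vs" using that us vs n by (metis nth_mem)
    then have "\<exists>!j. j < n \<and> vs ! j = us ! i"
      using vs n by (metis in_set_conv_nth nth_eq_iff_index_eq)
    then show ?thesis unfolding p_def by (rule theI')
  qed
  have pe: "us ! i = vs ! j \<longleftrightarrow> j = p i" if "i < n" "j < n" for i j
    using p[OF that(1)] that(2) vs n nth_eq_iff_index_eq by metis
  define q where "q j = (THE i. i < n \<and> us ! i = vs ! j)" for j
  have q: "q j < n \<and> us ! q j = vs ! j" if "j < n" for j
  proof -
    have "vs ! j \<in> set us" using that us vs n by (metis nth_mem)
    then have "\<exists>!i. i < n \<and> us ! i = vs ! j"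
      using us n by (metis in_set_conv_nth nth_eq_iff_index_eq)
    then show ?thesis unfolding q_def by (rule theI')
  qed
  have qe: "us ! i = vs ! j \<longleftrightarrow> i = q j" if "i < n" "j < n" for i j
    using q[OF that(2)] that(1) us n nth_eq_iff_index_eq by metis
  define P :: "real mat" where "P = mat n n (\<lambda>(i, j). if us ! i = vs ! j then 1 else 0)"
  define Q :: "real mat" where "Q = mat n n (\<lambda>(i, j). if us ! j = vs ! i then 1 else 0)"
  let ?A = "adj_mat_of us G" and ?B = "adj_mat_of vs G"
  have carr: "?A \<in> carrier_mat n n" "?B \<in> carrier_mat n n" "P \<in> carrier_mat n n"
    "Q \<in> carrier_mat n n"
    by (simp_all add: adj_mat_of_def P_def Q_def n)
  have PQ: "P * Q = 1\<^sub>m n"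
  proof (rule eq_matI)
    fix i j assume "i < dim_row (1\<^sub>m n)" "j < dim_col (1\<^sub>m n)"
    then have ij: "i < n" "j < n" by auto
    have "(P * Q) $$ (i, j) = (\<Sum>k = 0..<n. (if k = p i then 1 else 0) * (if k = p j then 1 else 0))"
      using ij by (auto simp: P_def Q_def scalar_prod_def pe intro!: sum.cong)
    also have "\<dots> = (\<Sum>k = 0..<n. if k = p i then (if p i = p j then 1 else 0) else 0)"
      by (intro sum.cong) auto
    also have "\<dots> = (if p i = p j then 1 else 0)" using p[OF ij(1)] by simp
    also have "p i = p j \<longleftrightarrow> i = j"
      using p ij us n nth_eq_iff_index_eq by metis
    finally show "(P * Q) $$ (i, j) = 1\<^sub>m n $$ (i, j)" using ij by simp
  qed (use carr in auto)
  have QP: "Q * P = 1\<^sub>m n"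
    using mat_mult_left_right_inverse[OF carr(3,4) PQ] .
  have "?A * P = P * ?B"
  proof (rule eq_matI)
    fix i j assume "i < dim_row (P * ?B)" "j < dim_col (P * ?B)"
    then have ij: "i < n" "j < n" using carr by auto
    have "(?A * P) $$ (i, j) =
        (\<Sum>k = 0..<n. (if (us ! i, us ! k) \<in> parcs G then 1 else 0) * (if k = q j then 1 else 0))"
      using ij by (auto simp: P_def adj_mat_of_def n scalar_prod_def qe intro!: sum.cong)
    also have "\<dots> = (\<Sum>k = 0..<n. if k = q j then (if (us ! i, us ! q j) \<in> parcs G then 1 else 0) else 0)"
      by (intro sum.cong) auto
    also have "\<dots> = (if (us ! i, vs ! j) \<in> parcs G then 1 else 0)" using q[OF ij(2)] by simp
    also have "\<dots> = (\<Sum>k = 0..<n. if k = p i then (if (vs ! p i, vs ! j) \<in> parcs G then 1 else 0) else 0)"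
      using p[OF ij(1)] by simp
    also have "\<dots> = (\<Sum>k = 0..<n. (if k = p i then 1 else 0) * (if (vs ! k, vs ! j) \<in> parcs G then 1 else 0))"
      by (intro sum.cong) auto
    also have "\<dots> = (P * ?B) $$ (i, j)"
      using ij by (auto simp: P_def adj_mat_of_def n scalar_prod_def pe intro!: sum.cong)
    finally show "(?A * P) $$ (i, j) = (P * ?B) $$ (i, j)" .
  qed (use carr in auto)
  then have "P * ?B * Q = ?A * P * Q" by simp
  also have "\<dots> = ?A" using carr PQ by (simp add: assoc_mult_mat[of _ n n _ n _ n])
  finally have "?A = P * ?B * Q" ..
  then have "similar_mat_wit ?A ?B P Q"
    using carr PQ QP by (intro similar_mat_witI[of _ _ n]) auto
  then show ?thesis unfolding similar_mat_def by blast
qed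

lemma char_poly_adj_mat:
  assumes "distinct vs" "set vs = pverts G"
  shows "char_poly (adj_mat G) = char_poly (adj_mat_of vs G)"
proof -
  have "distinct (SOME vs. distinct vs \<and> set vs = pverts G) \<and>
      set (SOME vs. distinct vs \<and> set vs = pverts G) = pverts G"
    by (rule someI[of _ vs]) (use assms in simp)
  then show ?thesis
    unfolding adj_mat_def using assms by (intro char_poly_similar similar_adj_mat_of) auto
qed

lemma spectrum_adj_mat:
  assumes "distinct vs" "set vs = pverts G"
  shows "spectrum (adj_mat G) = spectrum (adj_mat_of vs G)"
proof -
  have c: "adj_mat_of us G \<in> carrier_mat (length us) (length us)" for us
    by (simp add: adj_mat_of_def)
  have "spectrum (adj_mat_of us G) = {k. poly (char_poly (adj_mat_of us G)) k = 0}" for us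
    by (rule spectrum_root_char_poly[OF c])
  then show ?thesis
    using char_poly_adj_mat[OF assms] unfolding adj_mat_def by simp
qed

end

theory Submission
  imports Defs "HOL-Analysis.Convex"
begin

text \<open>
  Write the adjacency matrix of \<open>G\<close> as \<open>X - Y\<close> with \<open>X\<close>, \<open>Y\<close> positive semidefinite and
  \<open>tr (X Y) = 0\<close>, so that \<open>s_plus G\<close> and \<open>s_minus G\<close> are the sums of the squared entries of \<open>X\<close>
  and \<open>Y\<close>. Off the edges of \<open>G\<close> the matrices \<open>X\<close> and \<open>Y\<close> agree; let \<open>t\<close> be the sum of the squared
  entries there, and \<open>a\<close>, \<open>b\<close> the sums over the edges of the squared entries of \<open>X\<close> and \<open>Y\<close>.
  Then \<open>t\<^sup>2 \<le> a b\<close> by \<open>tr (X Y) = 0\<close> and Cauchy-Schwarz.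

  Let \<open>K = lambda_max H / \<bar>lambda_min H\<bar>\<close>. Suppose that \<open>H\<close> has a positive semidefinite matrix \<open>Z\<close>
  with entries \<open>-1\<close> on edges and diagonal at most \<open>K\<close>. Pulled back to \<open>G\<close>, its Schur product with
  \<open>X\<close> and \<open>X\<close> is positive semidefinite, so \<open>a \<le> K t\<close>, hence \<open>t \<le> K b\<close>; adding these gives
  \<open>s_plus G \<le> K s_minus G\<close>, and the other inequality is symmetric.

  To obtain \<open>Z\<close>, average \<open>z z\<^sup>T\<close> over the automorphisms of \<open>H\<close>, where \<open>z\<close> is an eigenvector for
  \<open>\<mu> = lambda_min H\<close>. The result \<open>F\<close> is constant on edges, say \<open>e\<close>, and the eigenvalue equation on
  the diagonal reads \<open>deg x * e = \<mu> * F x x\<close>. So dividing \<open>F x y\<close> by \<open>sqrt (deg x * deg y)\<close> makes the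
  diagonal constant (zero at isolated vertices). By edge-transitivity \<open>D = deg x * deg y\<close> is the same
  for all edges, the ratio of diagonal to edge entries becomes \<open>sqrt D / \<mu>\<close>, and
  \<open>sqrt D \<le> lambda_max H\<close> by the Rayleigh quotient at \<open>sqrt \<circ> deg\<close>.
\<close>

section \<open>Spectral theorem for real symmetric matrices\<close>

lemma unit_eigenvector:
  fixes a :: "nat \<Rightarrow> nat \<Rightarrow> real"
  assumes "eigenvalue (mat n n (\<lambda>(i, j). a i j)) \<mu>"
  obtains w where "(\<Sum>i<n. (w i)\<^sup>2) = 1" "\<And>i. i < n \<Longrightarrow> (\<Sum>j<n. a i j * w j) = \<mu> * w i"
proof -
  let ?A = "mat n n (\<lambda>(i, j). a i j)"
  obtain v where v: "v \<in> carrier_vec n" "v \<noteq> 0\<^sub>v n" "?A *\<^sub>v v = \<mu> \<cdot>\<^sub>v v"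
    using assms by (auto simp: eigenvalue_def eigenvector_def)
  have ev: "(\<Sum>j<n. a i j * v $ j) = \<mu> * v $ i" if "i < n" for i
  proof -
    have "(?A *\<^sub>v v) $ i = (\<mu> \<cdot>\<^sub>v v) $ i" using v by simp
    then show ?thesis using that v(1) by (simp add: scalar_prod_def atLeast0LessThan)
  qed
  define N where "N = (\<Sum>i<n. (v $ i)\<^sup>2)"
  obtain i where i: "i < n" "v $ i \<noteq> 0" using v by (metis eq_vecI carrier_vecD index_zero_vec)
  have "N > 0" unfolding N_def by (rule sum_pos2[of _ i]) (use i in auto)
  define w where "w i = v $ i / sqrt N" for i
  have "(\<Sum>i<n. (w i)\<^sup>2) = 1"
    using \<open>N > 0\<close> by (simp add: w_def power_divide flip: sum_divide_distrib N_def)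
  moreover have "(\<Sum>j<n. a i j * w j) = \<mu> * w i" if "i < n" for i
    using ev[OF that] by (simp add: w_def flip: sum_divide_distrib)
  ultimately show ?thesis by (rule that)
qed

text \<open>For an eigenvector \<open>v\<close>, the form \<open>s\<close>, conjugate-transpose of
  \<open>v\<close> times the matrix times \<open>v\<close>, equals \<open>e\<close> times the
  positive squared norm \<open>N\<close>. Symmetry and real entries make \<open>s\<close> equal to
  its conjugate, so \<open>e\<close> is real.\<close>

lemma complex_eigenvalue_symmetric_real:
  fixes a :: "nat \<Rightarrow> nat \<Rightarrow> real"
  assumes sym: "\<And>i j. i < n \<Longrightarrow> j < n \<Longrightarrow> a i j = a j i"
    and ev: "eigenvalue (mat n n (\<lambda>(i, j). complex_of_real (a i j))) e"
  shows "e \<in> \<real>"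
proof -
  let ?A = "mat n n (\<lambda>(i, j). complex_of_real (a i j))"
  obtain v where v: "v \<in> carrier_vec n" "v \<noteq> 0\<^sub>v n" "?A *\<^sub>v v = e \<cdot>\<^sub>v v"
    using ev by (auto simp: eigenvalue_def eigenvector_def)
  have ev: "(\<Sum>j<n. complex_of_real (a i j) * v $ j) = e * v $ i" if "i < n" for i
  proof -
    have "(?A *\<^sub>v v) $ i = (e \<cdot>\<^sub>v v) $ i" using v by simp
    then show ?thesis using that v(1) by (simp add: scalar_prod_def atLeast0LessThan)
  qed
  define N where "N = (\<Sum>i<n. (cmod (v $ i))\<^sup>2)"
  obtain i where i: "i < n" "v $ i \<noteq> 0" using v by (metis eq_vecI carrier_vecD index_zero_vec)
  have "N > 0" unfolding N_def by (rule sum_pos2[of _ i]) (use i in auto)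
  define s where "s = (\<Sum>i<n. \<Sum>j<n. cnj (v $ i) * (complex_of_real (a i j) * v $ j))"
  have "s = (\<Sum>i<n. cnj (v $ i) * (e * v $ i))"
    unfolding s_def by (intro sum.cong) (simp_all add: ev flip: sum_distrib_left)
  also have "\<dots> = e * N"
    unfolding N_def of_real_sum sum_distrib_left
    by (intro sum.cong) (simp_all add: complex_norm_square mult_ac del: of_real_power)
  finally have s: "s = e * N" .
  have "cnj s = (\<Sum>i<n. \<Sum>j<n. v $ i * (complex_of_real (a i j) * cnj (v $ j)))"
    by (simp add: s_def)
  also have "\<dots> = (\<Sum>j<n. \<Sum>i<n. v $ i * (complex_of_real (a i j) * cnj (v $ j)))"
    by (rule sum.swap)
  also have "\<dots> = s"
    unfolding s_def by (intro sum.cong) (auto simp: sym mult_ac)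
  finally have "cnj s = s" .
  with s \<open>N > 0\<close> have "cnj e = e" by simp
  then show ?thesis by (simp add: Reals_cnj_iff)
qed

text \<open>Complex Schur triangularisation supplies a nonzero eigenvalue, because a nilpotent real
  symmetric matrix vanishes. The eigenvalue is real by the previous lemma, and since characteristic
  polynomials commute with the embedding of the reals it is a root of the real one.\<close>

lemma nonzero_symmetric_nonzero_eigenvalue:
  fixes a :: "nat \<Rightarrow> nat \<Rightarrow> real"
  assumes sym: "\<And>i j. i < n \<Longrightarrow> j < n \<Longrightarrow> a i j = a j i"
    and nz: "i0 < n" "j0 < n" "a i0 j0 \<noteq> 0"
  obtains \<mu> where "\<mu> \<noteq> 0" "eigenvalue (mat n n (\<lambda>(i, j). a i j)) \<mu>"
proof -
  let ?R = "mat n n (\<lambda>(i, j). a i j)"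
  define A where "A = mat n n (\<lambda>(i, j). complex_of_real (a i j))"
  have A: "A \<in> carrier_mat n n" by (simp add: A_def)
  have AR: "A = map_mat of_real ?R" by (auto simp: A_def)
  obtain es where es: "char_poly A = (\<Prod>e\<leftarrow>es. [:- e, 1:])"
    using char_poly_factorized[OF A] by blast
  obtain B P Q where BPQ: "schur_decomposition A es = (B, P, Q)" by (metis prod_cases3)
  have sim: "similar_mat_wit A B P Q" and ut: "upper_triangular B" and dB: "diag_mat B = es"
    using schur_decomposition[OF A es BPQ] by auto
  note wit = similar_mat_witD2[OF A sim]
  \<comment> \<open>Otherwise \<open>tr (A\<^sup>2)\<close>, the sum of the squared entries of \<open>A\<close>, would vanish.\<close>
  have "\<exists>e\<in>set es. e \<noteq> 0"
  proof (rule ccontr)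
    assume "\<not> ?thesis"
    then have "B $$ (k, k) = 0" if "k < n" for k
      using dB wit(5) that by (force simp: diag_mat_def)
    then have tri: "B $$ (k, l) = 0" if "l \<le> k" "k < n" for k l
      using ut wit(5) that by (cases "l = k") (auto simp: upper_triangular_def)
    have B2: "(B * B) $$ (k, l) = 0" if "l \<le> k" "k < n" for k l
    proof -
      have "(B * B) $$ (k, l) = (\<Sum>m<n. B $$ (k, m) * B $$ (m, l))"
        using wit(5) that by (simp add: scalar_prod_def atLeast0LessThan)
      also have "\<dots> = 0"
      proof (rule sum.neutral, rule ballI)
        fix m assume "m \<in> {..<n}"
        then show "B $$ (k, m) * B $$ (m, l) = 0"
          using that tri[of m k] tri[of l m] by (cases "m \<le> k") auto
      qed
      finally show ?thesis .
    qed
    have AA: "A * A = P * ((B * B) * Q)"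
    proof -
      have "A * A = P * B * Q * (P * B * Q)" by (simp only: wit(3)[symmetric])
      also have "\<dots> = P * B * (Q * P) * (B * Q)"
        using wit(4-7) by (simp add: assoc_mult_mat[of _ n n _ n _ n])
      also have "\<dots> = P * ((B * B) * Q)"
        using wit(2,4-7) by (simp add: assoc_mult_mat[of _ n n _ n _ n])
      finally show ?thesis .
    qed
    define C where "C = B * B"
    have C: "C \<in> carrier_mat n n" using wit(5) by (simp add: C_def)
    \<comment> \<open>Cyclicity of the trace, by reordering sums: moving the sum over
      \<open>i\<close> innermost turns the outer factors into \<open>Q * P = 1\<close>, which leaves
      the trace of \<open>C\<close>.\<close>
    have "(\<Sum>i<n. (A * A) $$ (i, i)) = (\<Sum>i<n. \<Sum>k<n. \<Sum>l<n. P $$ (i, k) * (C $$ (k, l) * Q $$ (l, i)))"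
      unfolding AA C_def[symmetric] using wit(4-7) C
      by (simp add: scalar_prod_def atLeast0LessThan sum_distrib_left)
    also have "\<dots> = (\<Sum>k<n. \<Sum>l<n. \<Sum>i<n. P $$ (i, k) * (C $$ (k, l) * Q $$ (l, i)))"
      by (rule trans[OF sum.swap]) (rule sum.cong[OF refl], rule sum.swap)
    also have "\<dots> = (\<Sum>k<n. \<Sum>l<n. C $$ (k, l) * (Q * P) $$ (l, k))"
      using wit(4-7) 
      by (intro sum.cong refl) (simp add: scalar_prod_def atLeast0LessThan sum_distrib_left mult_ac)
    also have "\<dots> = (\<Sum>k<n. \<Sum>l<n. if l = k then C $$ (k, k) else 0)"
      unfolding wit(2) by (intro sum.cong refl) auto
    also have "\<dots> = 0" using B2 by (simp add: C_def)
    finally have "(\<Sum>i<n. (A * A) $$ (i, i)) = 0" .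
    moreover have "(\<Sum>i<n. (A * A) $$ (i, i)) = complex_of_real (\<Sum>i<n. \<Sum>j<n. (a i j)\<^sup>2)"
      unfolding of_real_sum
      by (intro sum.cong refl)
         (auto simp: A_def scalar_prod_def atLeast0LessThan power2_eq_square sym intro!: sum.cong)
    ultimately have "(\<Sum>i<n. \<Sum>j<n. (a i j)\<^sup>2) = 0" by (simp only: of_real_eq_0_iff)
    moreover have "(\<Sum>i<n. \<Sum>j<n. (a i j)\<^sup>2) > 0"
      by (rule sum_pos2[of _ i0], use nz in \<open>auto intro!: sum_pos2[of _ j0] sum_nonneg\<close>)
    ultimately show False by simp
  qed
  then obtain e where e: "e \<in> set es" "e \<noteq> 0" by blast
  have root: "poly (char_poly A) e = 0"
    using e(1) unfolding es by (force simp: poly_prod_list prod_list_zero_iff)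
  then have "e \<in> \<real>"
    using complex_eigenvalue_symmetric_real[of n a e, OF sym] eigenvalue_root_char_poly[OF A]
    unfolding A_def by blast
  then obtain \<mu> where \<mu>: "e = complex_of_real \<mu>" by (auto elim: Reals_cases)
  have "char_poly A = map_poly of_real (char_poly ?R)"
    unfolding AR by (rule of_real_hom.char_poly_hom[of _ n]) simp
  with root have "poly (char_poly ?R) \<mu> = 0"
    by (simp add: \<mu>)
  then have "eigenvalue ?R \<mu>" by (simp add: eigenvalue_root_char_poly[of _ n])
  then show ?thesis using that e \<mu> by auto
qed

section \<open>Orthonormal eigenvectors by deflation\<close>

text \<open>The \<open>m\<close> vectors, padded with zero rows, form a square matrix. Row
  \<open>m\<close> is zero, so the determinant vanishes, and a normalised kernel vector (an
  eigenvector for 0) is orthogonal to all of them.\<close>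

lemma exists_orthogonal_unit_vector:
  fixes v :: "nat \<Rightarrow> nat \<Rightarrow> real"
  assumes "m < n"
  obtains w where "(\<Sum>i<n. (w i)\<^sup>2) = 1" "\<And>k. k < m \<Longrightarrow> (\<Sum>i<n. v k i * w i) = 0"
proof -
  define c where "c k i = (if k < m then v k i else 0)" for k i
  let ?M = "mat n n (\<lambda>(k, i). c k i)"
  have "?M = mat\<^sub>r n n (\<lambda>k. if k = m then 0\<^sub>v n else vec n (c k))"
    by (rule eq_matI) (auto simp: c_def)
  also have "det \<dots> = 0" by (rule det_row_0) (use assms in auto)
  finally have "\<exists>x. x \<in> carrier_vec n \<and> x \<noteq> 0\<^sub>v n \<and> ?M *\<^sub>v x = 0\<^sub>v n"
    by (subst (asm) det_0_iff_vec_prod_zero_field[of _ n]) auto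
  then obtain x where x: "x \<in> carrier_vec n" "x \<noteq> 0\<^sub>v n" "?M *\<^sub>v x = 0\<^sub>v n" by blast
  moreover from x(1) have "0 \<cdot>\<^sub>v x = 0\<^sub>v n" by (intro eq_vecI) auto
  ultimately have "eigenvalue ?M 0" by (auto simp: eigenvalue_def eigenvector_def)
  from unit_eigenvector[OF this] obtain w where
    w: "(\<Sum>i<n. (w i)\<^sup>2) = 1" "\<And>k. k < n \<Longrightarrow> (\<Sum>i<n. c k i * w i) = 0 * w k" by blast
  have "(\<Sum>i<n. v k i * w i) = 0" if "k < m" for k
    using w(2)[of k] that assms by (simp add: c_def)
  with w(1) show ?thesis by (rule that)
qed

text \<open>On vectors orthogonal to all \<open>v k\<close>, the matrix \<open>a\<close> acts like
  its deflation \<open>b\<close>, so it suffices to find a unit eigenvector of \<open>b\<close> in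
  that orthogonal complement.\<close>

lemma orthonormal_eigenvectors_extend:
  fixes a v :: "nat \<Rightarrow> nat \<Rightarrow> real"
  assumes sym: "\<And>i j. i < n \<Longrightarrow> j < n \<Longrightarrow> a i j = a j i"
    and "m < n"
    and orth: "\<And>k l. k < m \<Longrightarrow> l < m \<Longrightarrow> (\<Sum>i<n. v k i * v l i) = (if k = l then 1 else 0)"
    and eig: "\<And>k i. k < m \<Longrightarrow> i < n \<Longrightarrow> (\<Sum>j<n. a i j * v k j) = lam k * v k i"
  obtains w \<mu> where "(\<Sum>i<n. (w i)\<^sup>2) = 1" "\<And>k. k < m \<Longrightarrow> (\<Sum>i<n. v k i * w i) = 0"
    "\<And>i. i < n \<Longrightarrow> (\<Sum>j<n. a i j * w j) = \<mu> * w i"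
proof -
  \<comment> \<open>Eigenvectors of the deflated matrix \<open>b\<close> for nonzero eigenvalues are orthogonal to all \<open>v k\<close>.\<close>
  define b where "b i j = a i j - (\<Sum>k<m. lam k * v k i * v k j)" for i j
  have bsym: "b i j = b j i" if "i < n" "j < n" for i j
    using sym[OF that] by (simp add: b_def mult_ac)
  have bw: "(\<Sum>j<n. b i j * w j) = (\<Sum>j<n. a i j * w j) - (\<Sum>k<m. lam k * v k i * (\<Sum>j<n. v k j * w j))" for i w
  proof -
    have "(\<Sum>j<n. (\<Sum>k<m. lam k * v k i * v k j) * w j) = (\<Sum>k<m. lam k * v k i * (\<Sum>j<n. v k j * w j))"
      unfolding sum_distrib_left sum_distrib_right by (subst sum.swap) (simp add: mult_ac)
    then show ?thesis by (simp add: b_def left_diff_distrib sum_subtractf)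
  qed
  have bv: "(\<Sum>j<n. b i j * v l j) = 0" if "i < n" "l < m" for i l
  proof -
    have "(\<Sum>k<m. lam k * v k i * (\<Sum>j<n. v k j * v l j)) = (\<Sum>k<m. if k = l then lam l * v l i else 0)"
      by (intro sum.cong) (auto simp: orth that)
    then show ?thesis using that by (simp add: bw eig)
  qed
  obtain w \<mu> where w: "(\<Sum>i<n. (w i)\<^sup>2) = 1" "\<And>k. k < m \<Longrightarrow> (\<Sum>i<n. v k i * w i) = 0"
    "\<And>i. i < n \<Longrightarrow> (\<Sum>j<n. b i j * w j) = \<mu> * w i"
  proof (cases "\<exists>i<n. \<exists>j<n. b i j \<noteq> 0")
    case True
    then obtain i0 j0 where nz: "i0 < n" "j0 < n" "b i0 j0 \<noteq> 0" by blast
    obtain \<mu> where \<mu>: "\<mu> \<noteq> 0" "eigenvalue (mat n n (\<lambda>(i, j). b i j)) \<mu>"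
      using nonzero_symmetric_nonzero_eigenvalue[of n b, OF bsym nz] by blast
    obtain w where w: "(\<Sum>i<n. (w i)\<^sup>2) = 1" "\<And>i. i < n \<Longrightarrow> (\<Sum>j<n. b i j * w j) = \<mu> * w i"
      using unit_eigenvector[OF \<mu>(2)] by blast
    have "(\<Sum>i<n. v k i * w i) = 0" if "k < m" for k
    proof -
      have "\<mu> * (\<Sum>i<n. v k i * w i) = (\<Sum>i<n. v k i * (\<Sum>j<n. b i j * w j))"
        unfolding sum_distrib_left[of \<mu>] by (intro sum.cong) (simp_all add: w(2))
      also have "\<dots> = (\<Sum>j<n. \<Sum>i<n. v k i * (b i j * w j))"
        unfolding sum_distrib_left by (rule sum.swap)
      also have "\<dots> = (\<Sum>j<n. w j * (\<Sum>i<n. b j i * v k i))"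
        unfolding sum_distrib_left by (intro sum.cong) (auto simp: bsym)
      also have "\<dots> = 0" using bv[OF _ that] by simp
      finally show ?thesis using \<mu>(1) by simp
    qed
    with w show ?thesis using that by blast
  next
    \<comment> \<open>Here \<open>b\<close> is zero, so any unit vector orthogonal to the
      \<open>v k\<close> is an eigenvector, for the eigenvalue 0.\<close>
    case False
    then have "(\<Sum>j<n. b i j * w j) = 0 * w i" if "i < n" for i w using that by simp
    moreover obtain w where "(\<Sum>i<n. (w i)\<^sup>2) = 1" "\<And>k. k < m \<Longrightarrow> (\<Sum>i<n. v k i * w i) = 0"
      using exists_orthogonal_unit_vector[OF \<open>m < n\<close>, of v] by blast
    ultimately show ?thesis using that[of w 0] by blast
  qed
  have "(\<Sum>j<n. a i j * w j) = \<mu> * w i" if "i < n" for i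
    using w(3)[OF that] by (simp add: bw w(2))
  with w(1,2) show ?thesis by (rule that)
qed

lemma orthonormal_eigenvectors:
  fixes a :: "nat \<Rightarrow> nat \<Rightarrow> real"
  assumes sym: "\<And>i j. i < n \<Longrightarrow> j < n \<Longrightarrow> a i j = a j i" and "m \<le> n"
  shows "\<exists>v lam. (\<forall>k<m. \<forall>l<m. (\<Sum>i<n. v k i * v l i) = (if k = l then 1 else 0)) \<and>
    (\<forall>k<m. \<forall>i<n. (\<Sum>j<n. a i j * v k j) = lam k * v k i)"
  using \<open>m \<le> n\<close>
proof (induction m)
  case (Suc m)
  then obtain v lam where
    orth: "\<And>k l. k < m \<Longrightarrow> l < m \<Longrightarrow> (\<Sum>i<n. v k i * v l i) = (if k = l then 1 else 0)"
    and eig: "\<And>k i. k < m \<Longrightarrow> i < n \<Longrightarrow> (\<Sum>j<n. a i j * v k j) = lam k * v k i"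
    by (metis Suc_leD)
  from Suc.prems have "m < n" by simp
  from orthonormal_eigenvectors_extend[of n a m v lam, OF sym this orth eig]
  obtain w \<mu> where w: "(\<Sum>i<n. (w i)\<^sup>2) = 1" "\<And>k. k < m \<Longrightarrow> (\<Sum>i<n. v k i * w i) = 0"
    "\<And>i. i < n \<Longrightarrow> (\<Sum>j<n. a i j * w j) = \<mu> * w i" by blast
  have "(\<Sum>i<n. w i * v k i) = 0" if "k < m" for k
    using w(2)[OF that] by (simp add: mult.commute)
  then show ?case
    using w orth eig
    by (intro exI[of _ "v(m := w)"] exI[of _ "lam(m := \<mu>)"])
       (auto simp: less_Suc_eq power2_eq_square)
qed simp

text \<open>Orthonormality says \<open>V * W = 1\<close>; for square matrices also
  \<open>W * V = 1\<close>, which is the completeness relation. The resulting similarity of the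
  matrix to the diagonal \<open>D\<close> gives the characteristic polynomial, hence the eigenvalues
  with multiplicity.\<close>

theorem symmetric_matrix_spectral_decomposition:
  fixes a :: "nat \<Rightarrow> nat \<Rightarrow> real"
  assumes sym: "\<And>i j. i < n \<Longrightarrow> j < n \<Longrightarrow> a i j = a j i"
  obtains v lam where
    "\<And>k l. k < n \<Longrightarrow> l < n \<Longrightarrow> (\<Sum>i<n. v k i * v l i) = (if k = l then 1 else 0)"
    "\<And>i j. i < n \<Longrightarrow> j < n \<Longrightarrow> (\<Sum>k<n. v k i * v k j) = (if i = j then 1 else 0)"
    "\<And>k i. k < n \<Longrightarrow> i < n \<Longrightarrow> (\<Sum>j<n. a i j * v k j) = lam k * v k i"
    "\<And>i j. i < n \<Longrightarrow> j < n \<Longrightarrow> a i j = (\<Sum>k<n. lam k * v k i * v k j)"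
    "char_poly (mat n n (\<lambda>(i, j). a i j)) = (\<Prod>k<n. [:- lam k, 1:])"
proof -
  obtain v lam where
    orth: "\<And>k l. k < n \<Longrightarrow> l < n \<Longrightarrow> (\<Sum>i<n. v k i * v l i) = (if k = l then 1 else 0)"
    and eig: "\<And>k i. k < n \<Longrightarrow> i < n \<Longrightarrow> (\<Sum>j<n. a i j * v k j) = lam k * v k i"
    using orthonormal_eigenvectors[of n a n, OF sym order_refl] by blast
  define V where "V = mat n n (\<lambda>(k, i). v k i)"
  define W where "W = mat n n (\<lambda>(i, k). v k i)"
  define D where "D = mat n n (\<lambda>(k, l). if k = l then lam k else 0)"
  let ?A = "mat n n (\<lambda>(i, j). a i j)"
  have carr: "V \<in> carrier_mat n n" "W \<in> carrier_mat n n" "D \<in> carrier_mat n n"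
    by (simp_all add: V_def W_def D_def)
  have VW: "V * W = 1\<^sub>m n"
    by (rule eq_matI) (auto simp: V_def W_def scalar_prod_def atLeast0LessThan orth)
  have WV: "W * V = 1\<^sub>m n"
    using mat_mult_left_right_inverse[OF carr(1,2) VW] .
  have complete: "(\<Sum>k<n. v k i * v k j) = (if i = j then 1 else 0)" if "i < n" "j < n" for i j
  proof -
    have "(W * V) $$ (i, j) = (1\<^sub>m n :: real mat) $$ (i, j)" using WV by simp
    then show ?thesis using that by (simp add: V_def W_def scalar_prod_def atLeast0LessThan)
  qed
  have decomp: "a i j = (\<Sum>k<n. lam k * v k i * v k j)" if "i < n" "j < n" for i j
  proof -
    have "a i j = (\<Sum>l<n. if l = j then a i j else 0)" using that by simp
    also have "\<dots> = (\<Sum>l<n. a i l * (\<Sum>k<n. v k l * v k j))"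
      by (intro sum.cong) (auto simp: complete that)
    also have "\<dots> = (\<Sum>k<n. \<Sum>l<n. a i l * (v k l * v k j))"
      unfolding sum_distrib_left by (rule sum.swap)
    also have "\<dots> = (\<Sum>k<n. (\<Sum>l<n. a i l * v k l) * v k j)"
      by (simp add: sum_distrib_right mult.assoc)
    also have "\<dots> = (\<Sum>k<n. lam k * v k i * v k j)"
      by (intro sum.cong) (simp_all add: eig that)
    finally show ?thesis .
  qed
  have DV: "D * V = mat n n (\<lambda>(k, j). lam k * v k j)"
  proof (rule eq_matI)
    fix k j assume "k < dim_row (mat n n (\<lambda>(k, j). lam k * v k j))"
      "j < dim_col (mat n n (\<lambda>(k, j). lam k * v k j))"
    then have kj: "k < n" "j < n" by auto
    have "(D * V) $$ (k, j) = (\<Sum>l<n. (if k = l then lam k else 0) * v l j)"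
      using kj by (simp add: D_def V_def scalar_prod_def atLeast0LessThan)
    also have "\<dots> = (\<Sum>l<n. if l = k then lam k * v k j else 0)"
      by (intro sum.cong) auto
    finally show "(D * V) $$ (k, j) = mat n n (\<lambda>(k, j). lam k * v k j) $$ (k, j)" using kj by simp
  qed (auto simp: D_def V_def)
  have "?A = W * (D * V)"
    unfolding DV
    by (rule eq_matI) (auto simp: W_def scalar_prod_def atLeast0LessThan decomp mult_ac intro!: sum.cong)
  then have "?A = W * D * V" using carr by (simp add: assoc_mult_mat[of _ n n _ n _ n])
  then have "similar_mat_wit ?A D W V"
    using carr VW WV by (intro similar_mat_witI[of _ _ n]) auto
  then have "char_poly ?A = char_poly D"
    by (intro char_poly_similar) (auto simp: similar_mat_def)
  also have "\<dots> = (\<Prod>e\<leftarrow>diag_mat D. [:- e, 1:])"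
    by (rule char_poly_upper_triangular[OF carr(3)]) (auto simp: D_def upper_triangular_def)
  also have "diag_mat D = map lam [0..<n]" by (auto simp: diag_mat_def D_def)
  also have "(\<Prod>e\<leftarrow>map lam [0..<n]. [:- e, 1:]) = (\<Prod>k<n. [:- lam k, 1:])"
    by (simp add: prod.distinct_set_conv_list[symmetric] atLeast0LessThan comp_def)
  finally show ?thesis using that orth complete eig decomp by blast
qed

section \<open>Adjacency spectrum and Rayleigh quotients\<close>

definition adj :: "'a pair_pre_digraph \<Rightarrow> 'a \<Rightarrow> 'a \<Rightarrow> real" where
  "adj G x y = of_bool ((x, y) \<in> parcs G)"

definition deg :: "'a pair_pre_digraph \<Rightarrow> 'a \<Rightarrow> real" where
  "deg G x = (\<Sum>y\<in>pverts G. adj G x y)"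

context pair_graph
begin

lemma adj_commute: "adj G x y = adj G y x"
  using pair_sym_arcs by (auto simp: adj_def symmetric_def dest: symD)

lemma adj_self [simp]: "adj G x x = 0"
  using pair_no_loops[of "(x, x)"] by (auto simp: adj_def)

text \<open>The enumeration \<open>vs\<close> need not be the one chosen in \<open>adj_mat\<close>:
  characteristic polynomial and spectrum do not depend on it. The former feeds \<open>s_plus\<close>
  and \<open>s_minus\<close>, the latter \<open>lambda_max\<close> and
  \<open>lambda_min\<close>.\<close>

lemma adj_spectral_decomposition:
  obtains vs v lam n where
    "n = length vs" "set vs = pverts G" "bij_betw ((!) vs) {..<n} (pverts G)"
    "\<And>k l. k < n \<Longrightarrow> l < n \<Longrightarrow> (\<Sum>i<n. v k i * v l i) = (if k = l then 1 else 0)"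
    "\<And>i j. i < n \<Longrightarrow> j < n \<Longrightarrow> (\<Sum>k<n. v k i * v k j) = (if i = j then 1 else 0)"
    "\<And>k i. k < n \<Longrightarrow> i < n \<Longrightarrow> (\<Sum>j<n. adj G (vs ! i) (vs ! j) * v k j) = lam k * v k i"
    "\<And>i j. i < n \<Longrightarrow> j < n \<Longrightarrow> adj G (vs ! i) (vs ! j) = (\<Sum>k<n. lam k * v k i * v k j)"
    "char_poly (adj_mat G) = (\<Prod>k<n. [:- lam k, 1:])"
    "spectrum (adj_mat G) = lam ` {..<n}"
proof -
  obtain vs where vs: "distinct vs" "set vs = pverts G"
    using finite_distinct_list[OF pair_finite_verts] by blast
  define n where "n = length vs"
  define a where "a i j = adj G (vs ! i) (vs ! j)" for i j
  have bij: "bij_betw ((!) vs) {..<n} (pverts G)"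
    using bij_betw_nth[OF vs(1), of "{..<n}" "pverts G"] vs(2) n_def by simp
  have sym: "a i j = a j i" for i j unfolding a_def by (rule adj_commute)
  from symmetric_matrix_spectral_decomposition[of n a, OF sym] obtain v lam where
    orth: "\<And>k l. k < n \<Longrightarrow> l < n \<Longrightarrow> (\<Sum>i<n. v k i * v l i) = (if k = l then 1 else 0)"
    and complete: "\<And>i j. i < n \<Longrightarrow> j < n \<Longrightarrow> (\<Sum>k<n. v k i * v k j) = (if i = j then 1 else 0)"
    and eig: "\<And>k i. k < n \<Longrightarrow> i < n \<Longrightarrow> (\<Sum>j<n. a i j * v k j) = lam k * v k i"
    and decomp: "\<And>i j. i < n \<Longrightarrow> j < n \<Longrightarrow> a i j = (\<Sum>k<n. lam k * v k i * v k j)"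
    and cp: "char_poly (mat n n (\<lambda>(i, j). a i j)) = (\<Prod>k<n. [:- lam k, 1:])"
    by blast
  have mat: "adj_mat_of vs G = mat n n (\<lambda>(i, j). a i j)"
    by (auto simp: adj_mat_of_def adj_def a_def n_def)
  have "char_poly (adj_mat G) = (\<Prod>k<n. [:- lam k, 1:])"
    unfolding char_poly_adj_mat[OF vs] mat cp ..
  moreover have "spectrum (adj_mat G) = lam ` {..<n}"
    unfolding spectrum_adj_mat[OF vs] mat
    by (subst spectrum_root_char_poly[of _ n]) (auto simp: cp poly_prod)
  ultimately show ?thesis
    using that[OF n_def vs(2) bij orth complete eig[unfolded a_def] decomp[unfolded a_def]] by blast
qed

lemma rayleigh_bounds:
  fixes f :: "'a \<Rightarrow> real"
  shows "lambda_min G * (\<Sum>x\<in>pverts G. (f x)\<^sup>2) \<le> (\<Sum>x\<in>pverts G. \<Sum>y\<in>pverts G. adj G x y * f x * f y)"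
      (is "?min")
    and "(\<Sum>x\<in>pverts G. \<Sum>y\<in>pverts G. adj G x y * f x * f y) \<le> lambda_max G * (\<Sum>x\<in>pverts G. (f x)\<^sup>2)"
      (is "?max")
proof -
  obtain vs v lam n where
    bij: "bij_betw ((!) vs) {..<n} (pverts G)"
    and complete: "\<And>i j. i < n \<Longrightarrow> j < n \<Longrightarrow> (\<Sum>k<n. v k i * v k j) = (if i = j then 1 else 0)"
    and decomp: "\<And>i j. i < n \<Longrightarrow> j < n \<Longrightarrow> adj G (vs ! i) (vs ! j) = (\<Sum>k<n. lam k * v k i * v k j)"
    and spec: "spectrum (adj_mat G) = lam ` {..<n}"
    by (rule adj_spectral_decomposition) blast
  define c where "c k = (\<Sum>i<n. v k i * f (vs ! i))" for k
  \<comment> \<open>Applied with \<open>q = lam\<close> for the quadratic form and with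
    \<open>q\<close> constantly 1 for the squared norm (Parseval).\<close>
  have form: "(\<Sum>i<n. \<Sum>j<n. (\<Sum>k<n. q k * v k i * v k j) * f (vs ! i) * f (vs ! j)) = (\<Sum>k<n. q k * (c k)\<^sup>2)" for q
  proof -
    have "(\<Sum>i<n. \<Sum>j<n. (\<Sum>k<n. q k * v k i * v k j) * f (vs ! i) * f (vs ! j)) =
      (\<Sum>i<n. \<Sum>j<n. \<Sum>k<n. q k * ((v k i * f (vs ! i)) * (v k j * f (vs ! j))))"
      unfolding sum_distrib_right by (simp add: mult_ac)
    also have "\<dots> = (\<Sum>i<n. \<Sum>k<n. \<Sum>j<n. q k * ((v k i * f (vs ! i)) * (v k j * f (vs ! j))))"
      by (rule sum.cong[OF refl], rule sum.swap)
    also have "\<dots> = (\<Sum>k<n. \<Sum>i<n. \<Sum>j<n. q k * ((v k i * f (vs ! i)) * (v k j * f (vs ! j))))"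
      by (rule sum.swap)
    also have "\<dots> = (\<Sum>k<n. q k * (c k)\<^sup>2)"
      unfolding c_def power2_eq_square sum_product unfolding sum_distrib_left ..
    finally show ?thesis .
  qed
  have quad: "(\<Sum>x\<in>pverts G. \<Sum>y\<in>pverts G. adj G x y * f x * f y) = (\<Sum>k<n. lam k * (c k)\<^sup>2)"
  proof -
    have "(\<Sum>x\<in>pverts G. \<Sum>y\<in>pverts G. adj G x y * f x * f y) =
        (\<Sum>i<n. \<Sum>j<n. adj G (vs ! i) (vs ! j) * f (vs ! i) * f (vs ! j))"
      by (simp flip: sum.reindex_bij_betw[OF bij])
    also have "\<dots> = (\<Sum>i<n. \<Sum>j<n. (\<Sum>k<n. lam k * v k i * v k j) * f (vs ! i) * f (vs ! j))"
      by (intro sum.cong refl) (simp add: decomp)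
    finally show ?thesis by (simp only: form)
  qed
  have norm: "(\<Sum>x\<in>pverts G. (f x)\<^sup>2) = (\<Sum>k<n. (c k)\<^sup>2)"
  proof -
    have "(\<Sum>x\<in>pverts G. (f x)\<^sup>2) = (\<Sum>i<n. (f (vs ! i))\<^sup>2)"
      by (simp flip: sum.reindex_bij_betw[OF bij])
    also have "\<dots> = (\<Sum>i<n. \<Sum>j<n. if j = i then (f (vs ! i))\<^sup>2 else 0)" by simp
    also have "\<dots> = (\<Sum>i<n. \<Sum>j<n. (\<Sum>k<n. 1 * v k i * v k j) * f (vs ! i) * f (vs ! j))"
      by (intro sum.cong refl) (auto simp: complete power2_eq_square)
    finally show ?thesis unfolding form by simp
  qed
  have bounds: "lambda_min G \<le> lam k \<and> lam k \<le> lambda_max G" if "k < n" for k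
    unfolding lambda_min_def lambda_max_def spec using that by simp
  show ?min ?max
    unfolding quad norm sum_distrib_left using bounds
    by (auto intro!: sum_mono mult_right_mono)
qed

lemma lambda_min_eigenvector:
  assumes "pverts G \<noteq> {}"
  obtains z where "(\<Sum>x\<in>pverts G. (z x)\<^sup>2) = 1"
    "\<And>x. x \<in> pverts G \<Longrightarrow> (\<Sum>y\<in>pverts G. adj G x y * z y) = lambda_min G * z x"
proof -
  obtain vs v lam n where
    n: "n = length vs" "set vs = pverts G"
    and bij: "bij_betw ((!) vs) {..<n} (pverts G)"
    and orth: "\<And>k l. k < n \<Longrightarrow> l < n \<Longrightarrow> (\<Sum>i<n. v k i * v l i) = (if k = l then 1 else 0)"
    and eig: "\<And>k i. k < n \<Longrightarrow> i < n \<Longrightarrow> (\<Sum>j<n. adj G (vs ! i) (vs ! j) * v k j) = lam k * v k i"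
    and spec: "spectrum (adj_mat G) = lam ` {..<n}"
    by (rule adj_spectral_decomposition) blast
  have "n > 0" using assms n by auto
  then have "lambda_min G \<in> lam ` {..<n}"
    unfolding lambda_min_def spec by (intro Min_in) auto
  then obtain k where k: "k < n" "lambda_min G = lam k" by auto
  define w where "w = v k"
  have w: "(\<Sum>i<n. (w i)\<^sup>2) = 1"
    "\<And>i. i < n \<Longrightarrow> (\<Sum>j<n. adj G (vs ! i) (vs ! j) * w j) = lambda_min G * w i"
    using orth[of k k] eig[of k] k by (simp_all add: w_def power2_eq_square)
  define z where "z x = w (the_inv_into {..<n} ((!) vs) x)" for x
  have z: "z (vs ! i) = w i" if "i < n" for i
    unfolding z_def using bij that by (simp add: the_inv_into_f_f bij_betw_def)
  have "(\<Sum>x\<in>pverts G. (z x)\<^sup>2) = 1"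
    using w(1) by (simp add: z flip: sum.reindex_bij_betw[OF bij])
  moreover have "(\<Sum>y\<in>pverts G. adj G x y * z y) = lambda_min G * z x" if x: "x \<in> pverts G" for x
  proof -
    obtain i where i: "i < n" "x = vs ! i" using x bij by (auto simp: bij_betw_def)
    show ?thesis using w(2)[OF i(1)] i by (simp add: z flip: sum.reindex_bij_betw[OF bij])
  qed
  ultimately show ?thesis by (rule that)
qed

end

section \<open>A vector colouring of an edge-transitive graph\<close>

lemma adj_graph_aut:
  assumes "graph_aut H h" "x \<in> pverts H" "y \<in> pverts H"
  shows "adj H (h x) (h y) = adj H x y"
  using assms by (auto simp: graph_aut_def adj_def)

lemma deg_graph_aut:
  assumes "graph_aut H h" "x \<in> pverts H"
  shows "deg H (h x) = deg H x"
proof -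
  have bij: "bij_betw h (pverts H) (pverts H)" using assms by (simp add: graph_aut_def)
  have "deg H (h x) = (\<Sum>y\<in>pverts H. adj H (h x) (h y))"
    unfolding deg_def by (rule sum.reindex_bij_betw[OF bij, symmetric])
  also have "\<dots> = deg H x"
    unfolding deg_def by (intro sum.cong refl) (simp add: adj_graph_aut assms)
  finally show ?thesis .
qed

text \<open>
  Restricting to functions that are undefined off the vertex set makes the set finite.
\<close>

definition ext_auts :: "'a pair_pre_digraph \<Rightarrow> ('a \<Rightarrow> 'a) set" where
  "ext_auts H = {g \<in> pverts H \<rightarrow>\<^sub>E pverts H. graph_aut H g}"

lemma finite_ext_auts: "finite (pverts H) \<Longrightarrow> finite (ext_auts H)"
  by (auto simp: ext_auts_def intro: finite_subset[OF _ finite_PiE[of "pverts H" "\<lambda>_. pverts H"]])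

lemma ext_auts_nonempty: "ext_auts H \<noteq> {}"
proof -
  have "restrict id (pverts H) \<in> ext_auts H"
    by (auto simp: ext_auts_def graph_aut_def bij_betw_def inj_on_def)
  then show ?thesis by blast
qed

text \<open>Composition with \<open>h\<close> permutes the finite set \<open>ext_auts H\<close>: it
  is injective because \<open>h\<close> is onto the vertices. The restriction keeps composites
  undefined off the vertex set.\<close>

lemma sum_ext_auts_shift:
  fixes F :: "('a \<Rightarrow> 'a) \<Rightarrow> real"
  assumes fin: "finite (pverts H)" and h: "graph_aut H h"
  shows "(\<Sum>g\<in>ext_auts H. F (restrict (g \<circ> h) (pverts H))) = (\<Sum>g\<in>ext_auts H. F g)"
proof -
  let ?V = "pverts H" and ?c = "\<lambda>g. restrict (g \<circ> h) (pverts H)"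
  have hbij: "bij_betw h ?V ?V" and hV: "\<And>x. x \<in> ?V \<Longrightarrow> h x \<in> ?V"
    using h by (auto simp: graph_aut_def bij_betw_def)
  have "?c g \<in> ext_auts H" if "g \<in> ext_auts H" for g
  proof -
    have g: "graph_aut H g" using that by (simp add: ext_auts_def)
    then have "bij_betw (g \<circ> h) ?V ?V"
      using hbij by (auto simp: graph_aut_def intro: bij_betw_trans)
    then have "bij_betw (?c g) ?V ?V" by (subst bij_betw_cong[of _ _ "g \<circ> h"]) auto
    moreover have "graph_aut H (?c g)"
      using calculation adj_graph_aut[OF g hV hV] adj_graph_aut[OF h]
      by (simp add: graph_aut_def adj_def of_bool_eq_iff)
    ultimately show ?thesis by (auto simp: ext_auts_def bij_betw_def)
  qed
  moreover have "inj_on ?c (ext_auts H)"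
  proof (rule inj_onI)
    fix g g' assume g: "g \<in> ext_auts H" "g' \<in> ext_auts H" and eq: "?c g = ?c g'"
    have "g y = g' y" if "y \<in> ?V" for y
    proof -
      obtain x where "x \<in> ?V" "y = h x" using hbij \<open>y \<in> ?V\<close> by (metis bij_betw_imp_surj_on imageE)
      then show ?thesis using fun_cong[OF eq, of x] by simp
    qed
    then show "g = g'" using g by (auto simp: ext_auts_def intro: PiE_ext)
  qed
  ultimately have "bij_betw ?c (ext_auts H) (ext_auts H)"
    using endo_inj_surj[OF finite_ext_auts[OF fin], of ?c] by (simp add: bij_betw_def image_subset_iff)
  then show ?thesis by (rule sum.reindex_bij_betw)
qed

section \<open>Signs of the extreme eigenvalues and the vector colouring\<close>

context pair_graph
begin

lemma deg_nonneg: "deg G x \<ge> 0"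
  by (auto simp: deg_def adj_def intro: sum_nonneg)

lemma deg_pos:
  assumes "(x, y) \<in> parcs G"
  shows "deg G x > 0"
  unfolding deg_def by (rule sum_pos2[of _ y])
    (use assms in \<open>auto simp: adj_def pair_finite_verts dest: in_arcsD2\<close>)

lemma sum_deg_pos:
  assumes "(x, y) \<in> parcs G"
  shows "(\<Sum>x\<in>pverts G. deg G x) > 0"
  by (rule sum_pos2[of _ x])
    (use assms in \<open>auto simp: deg_pos deg_nonneg pair_finite_verts dest: in_arcsD1\<close>)

text \<open>The Rayleigh quotient of the constant function 1 is the average degree.\<close>

lemma lambda_max_nonneg:
  assumes "pverts G \<noteq> {}"
  shows "lambda_max G \<ge> 0"
proof -
  have "0 \<le> (\<Sum>x\<in>pverts G. \<Sum>y\<in>pverts G. adj G x y * 1 * 1)"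
    by (auto simp: adj_def intro!: sum_nonneg)
  also have "\<dots> \<le> lambda_max G * (\<Sum>x\<in>pverts G. 1\<^sup>2)" by (rule rayleigh_bounds)
  finally show ?thesis using assms pair_finite_verts by (simp add: zero_le_mult_iff card_gt_0_iff)
qed

text \<open>The difference of the indicators of \<open>u\<close> and \<open>v\<close> has quadratic
  form -2 and squared norm 2, so \<open>lambda_min G\<close> is even at most -1.\<close>

lemma lambda_min_neg:
  assumes uv: "(u, v) \<in> parcs G"
  shows "lambda_min G < 0"
proof -
  define f :: "'a \<Rightarrow> real" where "f x = of_bool (x = u) - of_bool (x = v)" for x
  have V: "u \<in> pverts G" "v \<in> pverts G" and "u \<noteq> v"
    using uv pair_no_loops[OF uv] by (auto dest: in_arcsD1 in_arcsD2)
  have a: "adj G u v = 1" "adj G v u = 1" using uv adj_commute[of u v] by (auto simp: adj_def)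
  have ev: "(\<Sum>x\<in>pverts G. g x * f x) = g u - g v" for g
  proof -
    have "(\<Sum>x\<in>pverts G. g x * f x) =
        (\<Sum>x\<in>pverts G. (if x = u then g u else 0) - (if x = v then g v else 0))"
      by (intro sum.cong) (auto simp: f_def)
    then show ?thesis using V pair_finite_verts by (simp add: sum_subtractf)
  qed
  have "(\<Sum>x\<in>pverts G. \<Sum>y\<in>pverts G. adj G x y * f x * f y) = (\<Sum>x\<in>pverts G. (adj G x u - adj G x v) * f x)"
    by (intro sum.cong refl, subst ev) (simp add: left_diff_distrib)
  also have "\<dots> = -2" unfolding ev by (simp add: a)
  finally have "lambda_min G * (\<Sum>x\<in>pverts G. (f x)\<^sup>2) \<le> -2"
    using rayleigh_bounds(1)[of f] by simp
  moreover have "(\<Sum>x\<in>pverts G. (f x)\<^sup>2) = 2"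
    unfolding power2_eq_square ev using \<open>u \<noteq> v\<close> by (simp add: f_def)
  ultimately show ?thesis by simp
qed

text \<open>The values \<open>\<zeta> g x\<close> for \<open>g\<close> in \<open>\<Gamma>\<close>
  are the coordinates of a vector attached to \<open>x\<close>. Giving the matrix as a Gram matrix
  builds in its positive semidefiniteness and lets it be pulled back along any map into the
  vertices.\<close>

lemma edge_transitive_vector_colouring:
  assumes et: "edge_transitive G" and uv: "(u, v) \<in> parcs G"
  obtains \<Gamma> :: "('a \<Rightarrow> 'a) set" and \<zeta> :: "('a \<Rightarrow> 'a) \<Rightarrow> 'a \<Rightarrow> real" where
    "\<And>x y. (x, y) \<in> parcs G \<Longrightarrow> (\<Sum>g\<in>\<Gamma>. \<zeta> g x * \<zeta> g y) = -1"
    "\<And>x. x \<in> pverts G \<Longrightarrow> (\<Sum>g\<in>\<Gamma>. (\<zeta> g x)\<^sup>2) \<le> lambda_max G / \<bar>lambda_min G\<bar>"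
proof -
  let ?V = "pverts G" and ?\<Gamma> = "ext_auts G" and ?\<mu> = "lambda_min G"
  note fin = pair_finite_verts
  have V: "u \<in> ?V" "v \<in> ?V" using uv by (auto dest: in_arcsD1 in_arcsD2)
  have \<mu>: "?\<mu> < 0" using uv by (rule lambda_min_neg)
  obtain z where z: "(\<Sum>x\<in>?V. (z x)\<^sup>2) = 1"
    "\<And>x. x \<in> ?V \<Longrightarrow> (\<Sum>y\<in>?V. adj G x y * z y) = ?\<mu> * z x"
    using lambda_min_eigenvector V by blast
  define F where "F x y = (\<Sum>g\<in>?\<Gamma>. z (g x) * z (g y))" for x y
  have F_sym: "F x y = F y x" for x y by (simp add: F_def mult.commute)
  have F_aut: "F (h x) (h y) = F x y" if "graph_aut G h" "x \<in> ?V" "y \<in> ?V" for h x y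
    using sum_ext_auts_shift[OF fin that(1), of "\<lambda>g. z (g x) * z (g y)"] that by (simp add: F_def)
  have F_arc: "F x y = F u v" and deg_arc: "deg G x * deg G y = deg G u * deg G v"
    if xy: "(x, y) \<in> parcs G" for x y
  proof -
    obtain h where h: "graph_aut G h" "{h u, h v} = {x, y}"
      using et uv xy by (fastforce simp: edge_transitive_def)
    \<comment> \<open>The automorphism may reverse the edge; symmetry of \<open>F\<close> and
      commutativity of the degree product absorb this.\<close>
    then have *: "h u = x \<and> h v = y \<or> h u = y \<and> h v = x" by (auto simp: doubleton_eq_iff)
    show "F x y = F u v" using * F_aut[OF h(1) V] F_sym by metis
    show "deg G x * deg G y = deg G u * deg G v"
      using * deg_graph_aut[OF h(1) V(1)] deg_graph_aut[OF h(1) V(2)] by (metis mult.commute)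
  qed
  define e where "e = F u v"
  define D where "D = deg G u * deg G v"
  have "(v, u) \<in> parcs G" using uv adj_commute[of u v] by (auto simp: adj_def split: if_splits)
  then have D: "D > 0" using uv by (auto simp: D_def intro!: mult_pos_pos deg_pos)
  \<comment> \<open>Composing \<open>z\<close> with an automorphism gives another eigenvector for
    the same eigenvalue, so every column of \<open>F\<close> satisfies the eigenvalue
    equation.\<close>
  have F_eig: "(\<Sum>y\<in>?V. adj G x y * F y w) = ?\<mu> * F x w" if x: "x \<in> ?V" for x w
  proof -
    have "(\<Sum>y\<in>?V. adj G x y * z (g y)) = ?\<mu> * z (g x)" if g: "g \<in> ?\<Gamma>" for g
    proof -
      have aut: "graph_aut G g" using g by (simp add: ext_auts_def)
      then have bij: "bij_betw g ?V ?V" by (simp add: graph_aut_def)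
      have "(\<Sum>y\<in>?V. adj G x y * z (g y)) = (\<Sum>y\<in>?V. adj G (g x) (g y) * z (g y))"
        by (intro sum.cong refl) (simp add: adj_graph_aut aut x)
      also have "\<dots> = (\<Sum>y\<in>?V. adj G (g x) y * z y)"
        by (rule sum.reindex_bij_betw[OF bij])
      also have "\<dots> = ?\<mu> * z (g x)" using bij x by (intro z(2)) (auto simp: bij_betw_def)
      finally show ?thesis .
    qed
    then have "?\<mu> * F x w = (\<Sum>g\<in>?\<Gamma>. (\<Sum>y\<in>?V. adj G x y * z (g y)) * z (g w))"
      by (simp add: F_def sum_distrib_left mult.assoc)
    also have "\<dots> = (\<Sum>y\<in>?V. adj G x y * F y w)"
      unfolding F_def sum_distrib_left sum_distrib_right
      by (subst sum.swap) (simp add: mult.assoc)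
    finally show ?thesis ..
  qed
  have diag: "deg G x * e = ?\<mu> * F x x" if "x \<in> ?V" for x
  proof -
    have "?\<mu> * F x x = (\<Sum>y\<in>?V. adj G x y * F y x)" using F_eig[OF that] by simp
    also have "\<dots> = (\<Sum>y\<in>?V. adj G x y * e)"
      by (intro sum.cong refl) (auto simp: adj_def e_def F_sym[of _ x] dest: F_arc)
    finally show ?thesis by (simp add: deg_def sum_distrib_right)
  qed
  \<comment> \<open>The trace of \<open>F\<close> is the number of automorphisms in
    \<open>?\<Gamma>\<close>, hence positive. Summing \<open>diag\<close> over the vertices then
    compares signs.\<close>
  have "e < 0"
  proof -
    have "(\<Sum>x\<in>?V. F x x) = (\<Sum>g\<in>?\<Gamma>. \<Sum>x\<in>?V. (z (g x))\<^sup>2)"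
      unfolding F_def by (subst sum.swap) (simp add: power2_eq_square)
    also have "\<dots> = (\<Sum>g\<in>?\<Gamma>. 1)"
    proof (rule sum.cong[OF refl])
      fix g assume "g \<in> ?\<Gamma>"
      then have "bij_betw g ?V ?V" by (simp add: ext_auts_def graph_aut_def)
      from sum.reindex_bij_betw[OF this, of "\<lambda>x. (z x)\<^sup>2"] show "(\<Sum>x\<in>?V. (z (g x))\<^sup>2) = 1"
        using z(1) by simp
    qed
    also have "\<dots> > 0" using finite_ext_auts[OF fin] ext_auts_nonempty[of G] by (simp add: card_gt_0_iff)
    finally have "?\<mu> * (\<Sum>x\<in>?V. F x x) < 0" using \<mu> by (simp add: mult_neg_pos)
    also have "?\<mu> * (\<Sum>x\<in>?V. F x x) = (\<Sum>x\<in>?V. deg G x) * e"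
      unfolding sum_distrib_left sum_distrib_right by (intro sum.cong refl) (simp add: diag)
    finally show ?thesis using sum_deg_pos[OF uv] by (simp add: mult_less_0_iff)
  qed
  have "sqrt D \<le> lambda_max G"
  proof -
    \<comment> \<open>On each arc the product of the two square roots is \<open>sqrt D\<close>, and
      the degree sum counts the arcs.\<close>
    have "sqrt D * (\<Sum>x\<in>?V. deg G x) = (\<Sum>x\<in>?V. \<Sum>y\<in>?V. adj G x y * sqrt (deg G x) * sqrt (deg G y))"
      unfolding deg_def[of G] sum_distrib_left unfolding deg_def[symmetric]
      by (intro sum.cong refl) (auto simp: adj_def D_def simp flip: real_sqrt_mult dest: deg_arc)
    also have "\<dots> \<le> lambda_max G * (\<Sum>x\<in>?V. (sqrt (deg G x))\<^sup>2)" by (rule rayleigh_bounds)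
    also have "\<dots> = lambda_max G * (\<Sum>x\<in>?V. deg G x)" using deg_nonneg by simp
    finally show ?thesis using sum_deg_pos[OF uv] by simp
  qed
  \<comment> \<open>Scaling chosen so that the edge entries become
    \<open>r * r * e / sqrt D = -1\<close>.\<close>
  define r where "r = sqrt (sqrt D / \<bar>e\<bar>)"
  have r: "r * r = sqrt D / \<bar>e\<bar>"
    unfolding r_def using D by (intro real_sqrt_mult_self[THEN trans]) simp
  \<comment> \<open>At an isolated vertex the division by zero makes this 0, so the diagonal bound
    is trivial there.\<close>
  define \<zeta> where "\<zeta> g x = z (g x) * r / sqrt (deg G x)" for g x
  have \<zeta>: "(\<Sum>g\<in>?\<Gamma>. \<zeta> g x * \<zeta> g y) = sqrt D / \<bar>e\<bar> * F x y / sqrt (deg G x * deg G y)" for x y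
  proof -
    have "\<zeta> g x * \<zeta> g y = sqrt D / \<bar>e\<bar> / sqrt (deg G x * deg G y) * (z (g x) * z (g y))" for g
      unfolding r[symmetric] by (simp add: \<zeta>_def real_sqrt_mult mult_ac)
    then have "(\<Sum>g\<in>?\<Gamma>. \<zeta> g x * \<zeta> g y) = sqrt D / \<bar>e\<bar> / sqrt (deg G x * deg G y) * F x y"
      unfolding F_def sum_distrib_left by (intro sum.cong refl)
    then show ?thesis by simp
  qed
  show ?thesis
  proof (rule that[of \<zeta> ?\<Gamma>])
    fix x y assume xy: "(x, y) \<in> parcs G"
    show "(\<Sum>g\<in>?\<Gamma>. \<zeta> g x * \<zeta> g y) = -1"
      unfolding \<zeta> F_arc[OF xy] deg_arc[OF xy] e_def[symmetric] D_def[symmetric]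
      using D \<open>e < 0\<close> by simp
  next
    fix x assume x: "x \<in> ?V"
    have "(\<Sum>g\<in>?\<Gamma>. (\<zeta> g x)\<^sup>2) = sqrt D / \<bar>e\<bar> * F x x / sqrt (deg G x * deg G x)"
      unfolding power2_eq_square \<zeta> ..
    also have "\<dots> \<le> sqrt D / \<bar>?\<mu>\<bar>"
    proof (cases "deg G x = 0")
      case False
      have "F x x = deg G x * e / ?\<mu>" using diag[OF x] \<mu> by (simp add: eq_divide_eq mult.commute)
      moreover have "sqrt (deg G x * deg G x) = deg G x" using deg_nonneg by simp
      moreover have "\<bar>e\<bar> = - e" "\<bar>?\<mu>\<bar> = - ?\<mu>" using \<open>e < 0\<close> \<mu> by auto
      ultimately show ?thesis using \<open>e < 0\<close> False by simp
    qed (use D in simp)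
    also have "\<dots> \<le> lambda_max G / \<bar>?\<mu>\<bar>"
      using \<open>sqrt D \<le> lambda_max G\<close> by (intro divide_right_mono) auto
    finally show "(\<Sum>g\<in>?\<Gamma>. (\<zeta> g x)\<^sup>2) \<le> lambda_max G / \<bar>?\<mu>\<bar>" .
  qed
qed

end

section \<open>Positive and negative square energies\<close>

text \<open>For fixed \<open>k\<close> and \<open>l\<close> the sums over \<open>i\<close> and
  \<open>j\<close> factor into a square. With \<open>z\<close> constantly 1 this computes Frobenius
  inner products; with \<open>p = q\<close> nonnegative it is the Schur product theorem for an
  entrywise square.\<close>

lemma weighted_gram_sum:
  fixes v :: "nat \<Rightarrow> nat \<Rightarrow> real"
  shows "(\<Sum>i<n. \<Sum>j<n. (\<Sum>k<m. p k * v k i * v k j) * (\<Sum>l<m. q l * v l i * v l j) * (z i * z j)) =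
    (\<Sum>k<m. \<Sum>l<m. p k * q l * (\<Sum>i<n. v k i * v l i * z i)\<^sup>2)"
proof -
  have "(\<Sum>i<n. \<Sum>j<n. (\<Sum>k<m. p k * v k i * v k j) * (\<Sum>l<m. q l * v l i * v l j) * (z i * z j)) =
    (\<Sum>i<n. \<Sum>j<n. \<Sum>k<m. \<Sum>l<m. p k * q l * ((v k i * v l i * z i) * (v k j * v l j * z j)))"
    unfolding sum_product unfolding sum_distrib_right by (simp add: mult_ac)
  also have "\<dots> = (\<Sum>i<n. \<Sum>k<m. \<Sum>j<n. \<Sum>l<m. p k * q l * ((v k i * v l i * z i) * (v k j * v l j * z j)))"
    by (rule sum.cong[OF refl], rule sum.swap)
  also have "\<dots> = (\<Sum>k<m. \<Sum>i<n. \<Sum>j<n. \<Sum>l<m. p k * q l * ((v k i * v l i * z i) * (v k j * v l j * z j)))"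
    by (rule sum.swap)
  also have "\<dots> = (\<Sum>k<m. \<Sum>i<n. \<Sum>l<m. \<Sum>j<n. p k * q l * ((v k i * v l i * z i) * (v k j * v l j * z j)))"
    by (rule sum.cong[OF refl], rule sum.cong[OF refl], rule sum.swap)
  also have "\<dots> = (\<Sum>k<m. \<Sum>l<m. \<Sum>i<n. \<Sum>j<n. p k * q l * ((v k i * v l i * z i) * (v k j * v l j * z j)))"
    by (rule sum.cong[OF refl], rule sum.swap)
  also have "\<dots> = (\<Sum>k<m. \<Sum>l<m. p k * q l * (\<Sum>i<n. v k i * v l i * z i)\<^sup>2)"
    unfolding power2_eq_square sum_product unfolding sum_distrib_left ..
  finally show ?thesis .
qed

text \<open>The numerical core, with \<open>S\<close> standing for the matrix positions and
  \<open>E\<close> for those of edges. Keeping \<open>X\<close> and \<open>Y\<close> abstract allows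
  a second application with their roles exchanged.\<close>

lemma square_sum_le_of_weights:
  fixes X Y Z :: "'s \<Rightarrow> real"
  assumes fin: "finite S" and "E \<subseteq> S" and "K \<ge> 0"
    and off: "\<And>s. s \<in> S - E \<Longrightarrow> X s = Y s"
    and XY: "(\<Sum>s\<in>S. X s * Y s) = 0"
    and ZX: "0 \<le> (\<Sum>s\<in>S. Z s * (X s)\<^sup>2)"
    and ZE: "\<And>s. s \<in> E \<Longrightarrow> Z s = -1"
    and ZK: "\<And>s. s \<in> S \<Longrightarrow> Z s \<le> K"
  shows "(\<Sum>s\<in>S. (X s)\<^sup>2) \<le> K * (\<Sum>s\<in>S. (Y s)\<^sup>2)"
proof -
  define a where "a = (\<Sum>s\<in>E. (X s)\<^sup>2)"
  define b where "b = (\<Sum>s\<in>E. (Y s)\<^sup>2)"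
  define t where "t = (\<Sum>s\<in>S - E. (X s)\<^sup>2)"
  have split: "(\<Sum>s\<in>S. f s) = (\<Sum>s\<in>E. f s) + (\<Sum>s\<in>S - E. f s)" for f :: "'s \<Rightarrow> real"
    using sum.subset_diff[OF \<open>E \<subseteq> S\<close> fin, of f] by simp
  have pos: "a \<ge> 0" "b \<ge> 0" "t \<ge> 0" by (auto simp: a_def b_def t_def intro: sum_nonneg)
  have tY: "t = (\<Sum>s\<in>S - E. (Y s)\<^sup>2)" and tXY: "t = (\<Sum>s\<in>S - E. X s * Y s)"
    unfolding t_def by (auto intro!: sum.cong simp: off power2_eq_square)
  have "(\<Sum>s\<in>E. Z s * (X s)\<^sup>2) = - a"
    unfolding a_def sum_negf[symmetric] by (intro sum.cong) (auto simp: ZE)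
  moreover have "(\<Sum>s\<in>S - E. Z s * (X s)\<^sup>2) \<le> K * t"
    unfolding t_def sum_distrib_left by (intro sum_mono mult_right_mono) (auto intro: ZK)
  ultimately have at: "a \<le> K * t" using ZX unfolding split[of "\<lambda>s. Z s * (X s)\<^sup>2"] by simp
  have "(\<Sum>s\<in>E. X s * Y s) = - t" using XY tXY unfolding split[of "\<lambda>s. X s * Y s"] by simp
  then have "t\<^sup>2 \<le> a * b"
    using Cauchy_Schwarz_ineq_sum[of X Y E] by (simp add: a_def b_def)
  also have "\<dots> \<le> K * t * b" using at pos by (intro mult_right_mono)
  finally have "t * t \<le> t * (K * b)" by (simp add: power2_eq_square mult_ac)
  \<comment> \<open>A factor \<open>t\<close> is cancelled when \<open>t\<close> is positive; for
    \<open>t = 0\<close> the bound is the nonnegativity of \<open>K * b\<close>.\<close>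
  then have "t \<le> K * b"
    using pos \<open>K \<ge> 0\<close> by (cases "t = 0") (auto simp: mult_le_cancel_left)
  with at have "a + t \<le> K * (b + t)" by (simp add: distrib_left)
  then show ?thesis
    unfolding split[of "\<lambda>s. (X s)\<^sup>2"] split[of "\<lambda>s. (Y s)\<^sup>2"]
    by (simp only: a_def[symmetric] b_def[symmetric] t_def[symmetric] tY[symmetric])
qed

lemma sum_mset_filter_sum_singletons:
  fixes f :: "'b \<Rightarrow> 'c::comm_monoid_add"
  assumes "finite A"
  shows "(\<Sum>x\<in>#filter_mset P (\<Sum>k\<in>A. {#g k#}). f x) = (\<Sum>k\<in>A. if P (g k) then f (g k) else 0)"
  using assms by induction auto

context pair_graph
begin

text \<open>\<open>X\<close> and \<open>Y\<close> keep the eigenvectors and replace each eigenvalue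
  by its positive or negative part. These parts have product zero, whence the orthogonality; the
  last two claims say that the entrywise squares of \<open>X\<close> and \<open>Y\<close> are
  positive semidefinite.\<close>

lemma adj_signed_parts:
  obtains vs n X Y where "n = length vs" "set vs = pverts G"
    "\<And>i j. i < n \<Longrightarrow> j < n \<Longrightarrow> X i j - Y i j = adj G (vs ! i) (vs ! j)"
    "(\<Sum>i<n. \<Sum>j<n. (X i j)\<^sup>2) = s_plus G"
    "(\<Sum>i<n. \<Sum>j<n. (Y i j)\<^sup>2) = s_minus G"
    "(\<Sum>i<n. \<Sum>j<n. X i j * Y i j) = 0"
    "\<And>z :: nat \<Rightarrow> real. 0 \<le> (\<Sum>i<n. \<Sum>j<n. (X i j)\<^sup>2 * (z i * z j))"
    "\<And>z :: nat \<Rightarrow> real. 0 \<le> (\<Sum>i<n. \<Sum>j<n. (Y i j)\<^sup>2 * (z i * z j))"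
proof -
  obtain vs v lam n where
    n: "n = length vs" "set vs = pverts G"
    and orth: "\<And>k l. k < n \<Longrightarrow> l < n \<Longrightarrow> (\<Sum>i<n. v k i * v l i) = (if k = l then 1 else 0)"
    and decomp: "\<And>i j. i < n \<Longrightarrow> j < n \<Longrightarrow> adj G (vs ! i) (vs ! j) = (\<Sum>k<n. lam k * v k i * v k j)"
    and cp: "char_poly (adj_mat G) = (\<Prod>k<n. [:- lam k, 1:])"
    by (rule adj_spectral_decomposition) blast
  have ev: "adj_eigenvalues G = (\<Sum>k<n. {#lam k#})"
    unfolding adj_eigenvalues_def cp by (subst proots_prod) auto
  define M where "M p i j = (\<Sum>k<n. p k * v k i * v k j)" for p :: "nat \<Rightarrow> real" and i j
  define p where "p k = max (lam k) 0" for k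
  define q where "q k = max (- lam k) 0" for k
  \<comment> \<open>The rank-one matrices \<open>v k i * v k j\<close> are orthonormal for the
    Frobenius inner product.\<close>
  have inner: "(\<Sum>i<n. \<Sum>j<n. M r i j * M s i j) = (\<Sum>k<n. r k * s k)" for r s
  proof -
    have "(\<Sum>i<n. \<Sum>j<n. M r i j * M s i j) = (\<Sum>k<n. \<Sum>l<n. r k * s l * (\<Sum>i<n. v k i * v l i)\<^sup>2)"
      using weighted_gram_sum[where z = "\<lambda>_. 1"] by (simp add: M_def)
    also have "\<dots> = (\<Sum>k<n. \<Sum>l<n. if l = k then r k * s k else 0)"
      by (intro sum.cong refl) (auto simp: orth)
    finally show ?thesis by simp
  qed
  have psd: "0 \<le> (\<Sum>i<n. \<Sum>j<n. (M r i j)\<^sup>2 * (z i * z j))" if "\<And>k. r k \<ge> 0" for r z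
  proof -
    have "0 \<le> (\<Sum>k<n. \<Sum>l<n. r k * r l * (\<Sum>i<n. v k i * v l i * z i)\<^sup>2)"
      using that by (intro sum_nonneg mult_nonneg_nonneg) auto
    then show ?thesis
      unfolding M_def weighted_gram_sum[symmetric] by (simp only: power2_eq_square)
  qed
  show ?thesis
  proof (rule that[OF n])
    show "M p i j - M q i j = adj G (vs ! i) (vs ! j)" if "i < n" "j < n" for i j
      unfolding decomp[OF that] M_def sum_subtractf[symmetric]
      by (intro sum.cong refl) (auto simp: p_def q_def max_def)
    show "(\<Sum>i<n. \<Sum>j<n. (M p i j)\<^sup>2) = s_plus G"
      unfolding power2_eq_square inner s_plus_def ev
      by (subst sum_mset_filter_sum_singletons) (auto simp: p_def max_def intro!: sum.cong)
    show "(\<Sum>i<n. \<Sum>j<n. (M q i j)\<^sup>2) = s_minus G"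
      unfolding power2_eq_square inner s_minus_def ev
      by (subst sum_mset_filter_sum_singletons) (auto simp: q_def max_def intro!: sum.cong)
    show "(\<Sum>i<n. \<Sum>j<n. M p i j * M q i j) = 0"
      unfolding inner by (intro sum.neutral) (auto simp: p_def q_def max_def)
    show "0 \<le> (\<Sum>i<n. \<Sum>j<n. (M p i j)\<^sup>2 * (z i * z j))" for z by (rule psd) (simp add: p_def)
    show "0 \<le> (\<Sum>i<n. \<Sum>j<n. (M q i j)\<^sup>2 * (z i * z j))" for z by (rule psd) (simp add: q_def)
  qed
qed

end

section \<open>Pulling the colouring back along the homomorphism\<close>

lemma signed_square_energies_comparable:
  assumes G: "pair_graph G" and H: "pair_graph H" "pverts H \<noteq> {}" "edge_transitive H"
    and hom: "graph_hom G H \<phi>"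
  defines "K \<equiv> lambda_max H / \<bar>lambda_min H\<bar>"
  shows "s_plus G \<le> K * s_minus G" "s_minus G \<le> K * s_plus G"
proof -
  have K: "K \<ge> 0" unfolding K_def using pair_graph.lambda_max_nonneg[OF H(1,2)] by simp
  obtain vs n X Y where n: "n = length vs" "set vs = pverts G"
    and XY: "\<And>i j. i < n \<Longrightarrow> j < n \<Longrightarrow> X i j - Y i j = adj G (vs ! i) (vs ! j)"
    and X2: "(\<Sum>i<n. \<Sum>j<n. (X i j)\<^sup>2) = s_plus G"
    and Y2: "(\<Sum>i<n. \<Sum>j<n. (Y i j)\<^sup>2) = s_minus G"
    and inner: "(\<Sum>i<n. \<Sum>j<n. X i j * Y i j) = 0"
    and psd: "\<And>z :: nat \<Rightarrow> real. 0 \<le> (\<Sum>i<n. \<Sum>j<n. (X i j)\<^sup>2 * (z i * z j))"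
      "\<And>z :: nat \<Rightarrow> real. 0 \<le> (\<Sum>i<n. \<Sum>j<n. (Y i j)\<^sup>2 * (z i * z j))"
    by (rule pair_graph.adj_signed_parts[OF G]) (rule that)
  define S where "S = {..<n} \<times> {..<n}"
  define E where "E = {(i, j) \<in> S. (vs ! i, vs ! j) \<in> parcs G}"
  have S: "finite S" "E \<subseteq> S" by (auto simp: S_def E_def)
  have sumS: "(\<Sum>i<n. \<Sum>j<n. f i j) = (\<Sum>s\<in>S. f (fst s) (snd s))" for f :: "nat \<Rightarrow> nat \<Rightarrow> real"
    unfolding S_def sum.cartesian_product by (simp add: case_prod_beta)
  have "\<exists>Z. (\<forall>s\<in>E. Z s = -1) \<and> (\<forall>s\<in>S. Z s \<le> K) \<and>
    0 \<le> (\<Sum>s\<in>S. Z s * (X (fst s) (snd s))\<^sup>2) \<and> 0 \<le> (\<Sum>s\<in>S. Z s * (Y (fst s) (snd s))\<^sup>2)"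
  proof (cases "parcs H = {}")
    \<comment> \<open>Without arcs in \<open>H\<close> there are none in \<open>G\<close>, so only
      the upper bound by \<open>K\<close> is left to meet, and zero weights do.\<close>
    case True
    then have "E = {}" using hom by (auto simp: E_def graph_hom_def)
    then show ?thesis using K by (intro exI[of _ "\<lambda>_. 0"]) simp
  next
    case False
    then obtain x y where xy: "(x, y) \<in> parcs H" by auto
    obtain \<Gamma> and \<zeta> :: "('b \<Rightarrow> 'b) \<Rightarrow> 'b \<Rightarrow> real" where
      arc: "\<And>x y. (x, y) \<in> parcs H \<Longrightarrow> (\<Sum>g\<in>\<Gamma>. \<zeta> g x * \<zeta> g y) = -1"
      and diag: "\<And>x. x \<in> pverts H \<Longrightarrow> (\<Sum>g\<in>\<Gamma>. (\<zeta> g x)\<^sup>2) \<le> K"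
      unfolding K_def by (rule pair_graph.edge_transitive_vector_colouring[OF H(1,3) xy]) (rule that[unfolded K_def])
    define w where "w g i = \<zeta> g (\<phi> (vs ! i))" for g i
    define Z where "Z i j = (\<Sum>g\<in>\<Gamma>. w g i * w g j)" for i j
    have \<phi>: "\<phi> (vs ! i) \<in> pverts H" if "i < n" for i
      using hom n that nth_mem[of i vs] by (auto simp: graph_hom_def)
    have "Z i j = -1" if "(i, j) \<in> E" for i j
      using that hom by (auto simp: E_def Z_def w_def graph_hom_def intro: arc)
    moreover have "Z i j \<le> K" if "i < n" "j < n" for i j
    proof -
      \<comment> \<open>All entries, not just diagonal ones, must be at most \<open>K\<close>: twice
        a product is at most the sum of the squares, which are diagonal entries.\<close>
      have "2 * Z i j \<le> (\<Sum>g\<in>\<Gamma>. (w g i)\<^sup>2 + (w g j)\<^sup>2)"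
        unfolding Z_def sum_distrib_left
        using sum_squares_bound by (intro sum_mono) (simp add: mult.assoc)
      also have "\<dots> \<le> K + K"
        unfolding sum.distrib w_def using diag[OF \<phi>] that by (intro add_mono) auto
      finally show ?thesis by simp
    qed
    moreover have "0 \<le> (\<Sum>s\<in>S. Z (fst s) (snd s) * (W (fst s) (snd s))\<^sup>2)"
      if psd: "\<And>z :: nat \<Rightarrow> real. 0 \<le> (\<Sum>i<n. \<Sum>j<n. (W i j)\<^sup>2 * (z i * z j))" for W
    proof -
      \<comment> \<open>Splitting \<open>Z\<close> into the rank-one terms
        \<open>w g i * w g j\<close> reduces the claim to the quadratic form of the entrywise square
        of \<open>W\<close> at each \<open>w g\<close>.\<close>
      have "(\<Sum>s\<in>S. Z (fst s) (snd s) * (W (fst s) (snd s))\<^sup>2) =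
          (\<Sum>s\<in>S. \<Sum>g\<in>\<Gamma>. (W (fst s) (snd s))\<^sup>2 * (w g (fst s) * w g (snd s)))"
        unfolding Z_def sum_distrib_right by (intro sum.cong refl) (rule mult.commute)
      also have "\<dots> = (\<Sum>g\<in>\<Gamma>. \<Sum>s\<in>S. (W (fst s) (snd s))\<^sup>2 * (w g (fst s) * w g (snd s)))"
        by (rule sum.swap)
      also have "\<dots> \<ge> 0"
      proof (rule sum_nonneg)
        fix g
        show "0 \<le> (\<Sum>s\<in>S. (W (fst s) (snd s))\<^sup>2 * (w g (fst s) * w g (snd s)))"
          using psd[of "w g"] unfolding sumS .
      qed
      finally show ?thesis .
    qed
    ultimately show ?thesis
      using psd by (intro exI[of _ "\<lambda>s. Z (fst s) (snd s)"]) (auto simp: S_def)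
  qed
  then obtain Z where Z: "\<And>s. s \<in> E \<Longrightarrow> Z s = -1" "\<And>s. s \<in> S \<Longrightarrow> Z s \<le> K"
    "0 \<le> (\<Sum>s\<in>S. Z s * (X (fst s) (snd s))\<^sup>2)" "0 \<le> (\<Sum>s\<in>S. Z s * (Y (fst s) (snd s))\<^sup>2)"
    by blast
  have off: "X (fst s) (snd s) = Y (fst s) (snd s)" if "s \<in> S - E" for s
    using that XY[of "fst s" "snd s"]
    by (cases "(vs ! fst s, vs ! snd s) \<in> parcs G") (auto simp: S_def E_def adj_def)
  have inner': "(\<Sum>s\<in>S. X (fst s) (snd s) * Y (fst s) (snd s)) = 0"
    "(\<Sum>s\<in>S. Y (fst s) (snd s) * X (fst s) (snd s)) = 0"
    using inner unfolding sumS by (simp_all only: mult.commute)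
  show "s_plus G \<le> K * s_minus G"
    unfolding X2[symmetric] Y2[symmetric] sumS
    by (rule square_sum_le_of_weights[OF S K off inner'(1) Z(3,1,2)])
  show "s_minus G \<le> K * s_plus G"
    unfolding X2[symmetric] Y2[symmetric] sumS
    by (rule square_sum_le_of_weights[OF S K off[symmetric] inner'(2) Z(4,1,2)])
qed

theorem theorem1p3:
  fixes G :: "'a pair_pre_digraph" and H :: "'b pair_pre_digraph"
  assumes "pair_graph G" and "pair_graph H"
    and "pverts H \<noteq> {}"
    and "edge_transitive H"
    and "\<exists>\<phi>. graph_hom G H \<phi>"
  shows "lambda_max H / \<bar>lambda_min H\<bar> \<ge> max (s_plus G / s_minus G) (s_minus G / s_plus G)"
proof -
  let ?K = "lambda_max H / \<bar>lambda_min H\<bar>"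
  obtain \<phi> where "graph_hom G H \<phi>" using assms(5) by blast
  note le = signed_square_energies_comparable[OF assms(1-4) this]
  have K: "?K \<ge> 0" using pair_graph.lambda_max_nonneg[OF assms(2,3)] by simp
  have "0 \<le> (\<Sum>x\<in>#M. x\<^sup>2)" for M :: "real multiset" by (induction M) auto
  then have "s_plus G \<ge> 0" "s_minus G \<ge> 0" by (simp_all add: s_plus_def s_minus_def)
  \<comment> \<open>For \<open>y = 0\<close> the quotient is 0 by convention and
    \<open>0 \<le> k\<close> suffices; this covers a graph \<open>G\<close> without edges, where
    both energies vanish.\<close>
  moreover have "x / y \<le> k" if "x \<le> k * y" "0 \<le> y" "0 \<le> k" for x y k :: real
    using that by (cases "y = 0") (simp_all add: pos_divide_le_eq)
  ultimately have "s_plus G / s_minus G \<le> ?K" "s_minus G / s_plus G \<le> ?K"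
    using le K by blast+
  then show ?thesis by (rule max.boundedI)
qed

end
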